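(* Given any non-orthogonal, linearly independent pair of vectors $V_1,V_2\in\mathbb{R}^2$ and any $\rho>0$, there is a real $2\times2$ matrix $B$ with eigenvectors $V_1,V_2$ for which the system $\frac{dX}{dt}=BX$ has an attractor (at the origin) with reactivity $\rho$.
   Context: For $X_0\in\mathbb{R}^2$ let $X(t)$ be the solution of $\frac{dX}{dt}=BX$ with $X(0)=X_0$, let $r(t)=\|X(t)\|$ (Euclidean norm) and $r_0=\|X_0\|$. The reactivity of the system is $\max_{X_0\ne0}\left(\frac1{r_0}\frac{dr}{dt}\Big|_{t=0}\right)$. The origin is an attractor when all eigenvalues of $B$ have negative real part. *)

theory Defs
  imports "HOL-Analysis.Analysis"
begin

definition eigenpair :: "'a::field ^ 'n ^ 'n \<Rightarrow> 'a \<Rightarrow> 'a ^ 'n \<Rightarrow> bool" where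
  "eigenpair A c v \<longleftrightarrow> v \<noteq> 0 \<and> A *v v = c *s v"

definition eigenvector :: "'a::field ^ 'n ^ 'n \<Rightarrow> 'a ^ 'n \<Rightarrow> bool" where
  "eigenvector A v \<longleftrightarrow> (\<exists>c. eigenpair A c v)"

definition eigenvalue :: "'a::field ^ 'n ^ 'n \<Rightarrow> 'a \<Rightarrow> bool" where
  "eigenvalue A c \<longleftrightarrow> (\<exists>v. eigenpair A c v)"

definition solves_linear_ivp ::
    "real ^ 'n ^ 'n \<Rightarrow> real ^ 'n \<Rightarrow> (real \<Rightarrow> real ^ 'n) \<Rightarrow> bool" where
  "solves_linear_ivp B X0 X \<longleftrightarrow>
     X 0 = X0 \<and> (\<forall>t. (X has_vector_derivative B *v X t) (at t))"

text \<open>All complex eigenvalues of the real matrix are considered, hence the complexification.\<close>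

definition origin_attractor :: "real ^ 'n ^ 'n \<Rightarrow> bool" where
  "origin_attractor B \<longleftrightarrow> (\<forall>c. eigenvalue (map_matrix complex_of_real B) c \<longrightarrow> Re c < 0)"

text \<open>The values \<open>(1 / r0) * dr/dt\<close> at \<open>t = 0\<close>, where \<open>r t = norm (X t)\<close>, over all
  nonzero initial values. The derivative \<open>D\<close> is described relationally, so that no junk
  value of \<open>deriv\<close> can enter.\<close>

definition initial_growth_rates :: "real ^ 'n ^ 'n \<Rightarrow> real set" where
  "initial_growth_rates B =
     {1 / norm X0 * D | X0 X D. X0 \<noteq> 0 \<and> solves_linear_ivp B X0 X \<and>
        ((\<lambda>t. norm (X t)) has_real_derivative D) (at 0)}"

text \<open>The maximum is required to be attained; \<open>Max\<close> is unusable as the set is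
  in general infinite.\<close>

definition has_reactivity :: "real ^ 'n ^ 'n \<Rightarrow> real \<Rightarrow> bool" where
  "has_reactivity B \<rho> \<longleftrightarrow>
     \<rho> \<in> initial_growth_rates B \<and> (\<forall>s \<in> initial_growth_rates B. s \<le> \<rho>)"

end

theory Submission
  imports Defs
begin

text \<open>Let \<open>w\<close> be the component of \<open>V\<^sub>2\<close> orthogonal to \<open>V\<^sub>1\<close> and \<open>n = w / (w \<bullet> w)\<close>, so that
  \<open>P x = (n \<bullet> x) V\<^sub>2\<close> is the projection onto \<open>V\<^sub>2\<close> along \<open>V\<^sub>1\<close>. Non-orthogonality makes the projection
  oblique, that is \<open>\<kappa> = norm n * norm V\<^sub>2 > 1\<close>, and the minimum of \<open>x \<bullet> P x\<close> on the unit sphere is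
  \<open>(1 - \<kappa>) / 2 < 0\<close>. Hence \<open>B = - I - b P\<close> has eigenvalues \<open>-1\<close> and \<open>-1 - b\<close>, and
  reactivity \<open>b (\<kappa> - 1) / 2 - 1\<close>, which equals \<open>\<rho>\<close> for \<open>b = 2 (\<rho> + 1) / (\<kappa> - 1)\<close>.\<close>

definition rank_one_update :: "real \<Rightarrow> real \<Rightarrow> real ^ 'n \<Rightarrow> real ^ 'n \<Rightarrow> real ^ 'n ^ 'n" where
  "rank_one_update a b n v = (\<chi> i j. - (if i = j then a else 0) - b * v $ i * n $ j)"

lemma rank_one_update_mult_vec:
  "rank_one_update a b n v *v x = - (a *\<^sub>R x) - (b * (n \<bullet> x)) *\<^sub>R v"
proof -
  have "(rank_one_update a b n v *v x) $ i =
     (\<Sum>j\<in>UNIV. - (if i = j then a * x $ j else 0) - b * (n $ j * x $ j) * v $ i)" for i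
    unfolding matrix_vector_mult_def rank_one_update_def
    by (auto intro!: sum.cong simp: algebra_simps)
  then show ?thesis
    by (simp add: vec_eq_iff inner_vec_def sum_subtractf sum_negf sum_distrib_left sum_distrib_right)
qed

text \<open>Attraction is stated through complex eigenvectors. The pairing with \<open>n\<close> is
  bilinear, without conjugation, so it is an explicit sum and not an inner product.\<close>

lemma complex_rank_one_update_mult_vec:
  "(map_matrix complex_of_real (rank_one_update a b n v) *v z) $ i =
     - (of_real a * z $ i) - of_real b * (\<Sum>j\<in>UNIV. of_real (n $ j) * z $ j) * of_real (v $ i)"
proof -
  have "(map_matrix complex_of_real (rank_one_update a b n v) *v z) $ i =
     (\<Sum>j\<in>UNIV. - (if i = j then of_real a * z $ j else 0)
        - of_real b * (of_real (n $ j) * z $ j) * of_real (v $ i))"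
    unfolding matrix_vector_mult_def map_matrix_def rank_one_update_def
    by (auto intro!: sum.cong simp: algebra_simps)
  then show ?thesis
    by (simp add: sum_subtractf sum_negf sum_distrib_left sum_distrib_right)
qed

text \<open>Pairing the eigenvector equation with \<open>n\<close> gives
  \<open>(c + a + b) * m = 0\<close>, where \<open>m\<close> is the pairing of \<open>n\<close> with
  \<open>z\<close>. If \<open>m = 0\<close>, the rank-one term vanishes on \<open>z\<close> and only
  \<open>c = - a\<close> remains.\<close>

lemma origin_attractor_rank_one_update:
  assumes "n \<bullet> v = 1" "a > 0" "a + b > 0"
  shows "origin_attractor (rank_one_update a b n v)"
  unfolding origin_attractor_def
proof (intro allI impI)
  fix c assume "eigenvalue (map_matrix complex_of_real (rank_one_update a b n v)) c"
  then obtain z where "z \<noteq> 0"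
    and z: "map_matrix complex_of_real (rank_one_update a b n v) *v z = c *s z"
    unfolding eigenvalue_def eigenpair_def by blast
  define m where "m = (\<Sum>j\<in>UNIV. complex_of_real (n $ j) * z $ j)"
  have eq: "c * z $ i = - (of_real a * z $ i) - of_real b * m * of_real (v $ i)" for i
    using complex_rank_one_update_mult_vec[of a b n v z i] z by (simp add: m_def)
  have nv: "(\<Sum>j\<in>UNIV. complex_of_real (n $ j) * of_real (v $ j)) = 1"
    using assms(1) by (simp add: inner_vec_def flip: of_real_mult of_real_sum)
  have "c * m = (\<Sum>j\<in>UNIV. complex_of_real (n $ j) * (c * z $ j))"
    by (simp add: m_def sum_distrib_left mult_ac)
  also have "\<dots> = - of_real a * m
      - of_real b * m * (\<Sum>j\<in>UNIV. complex_of_real (n $ j) * of_real (v $ j))"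
  proof -
    have "(\<Sum>j\<in>UNIV. complex_of_real (n $ j) * (c * z $ j)) =
        (\<Sum>j\<in>UNIV. - of_real a * (of_real (n $ j) * z $ j)
           - of_real b * m * (of_real (n $ j) * of_real (v $ j)))"
      unfolding eq by (simp add: algebra_simps)
    then show ?thesis
      by (simp add: sum_subtractf sum_negf m_def flip: sum_distrib_left)
  qed
  finally have "(c + of_real (a + b)) * m = 0"
    by (simp add: nv distrib_right)
  then consider "c = - of_real (a + b)" | "m = 0"
    by (auto simp: add_eq_0_iff2)
  then show "Re c < 0"
  proof cases
    case 1
    then show ?thesis using assms by simp
  next
    case 2
    obtain i where "z $ i \<noteq> 0"
      using \<open>z \<noteq> 0\<close> by (auto simp: vec_eq_iff)
    moreover have "(c + of_real a) * z $ i = 0"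
      using eq[of i] 2 by (simp add: algebra_simps)
    ultimately have "c = - of_real a"
      by (simp add: add_eq_0_iff2)
    then show ?thesis using assms by simp
  qed
qed

text \<open>Each initial value splits into a part killed by \<open>n\<close>, on which the matrix
  acts as \<open>- a\<close>, and a multiple of \<open>v\<close>, on which it acts as
  \<open>- (a + b)\<close>. The explicit solution is what shows that the maximal growth rate is
  attained.\<close>

lemma solves_rank_one_update:
  assumes "n \<bullet> v = 1"
  shows "solves_linear_ivp (rank_one_update a b n v) x
    (\<lambda>t. exp (- a * t) *\<^sub>R (x - (n \<bullet> x) *\<^sub>R v) + (exp (- (a + b) * t) * (n \<bullet> x)) *\<^sub>R v)"
  unfolding solves_linear_ivp_def rank_one_update_mult_vec
proof (intro conjI allI, goal_cases)
  case (2 t)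
  show ?case
    by (rule derivative_eq_intros refl | simp)+
      (simp add: assms algebra_simps)
qed simp

text \<open>Chain rule: away from zero the gradient of the norm is \<open>sgn\<close>. The initial
  growth thus depends on \<open>x\<close> alone, not on the chosen solution.\<close>

lemma has_real_derivative_norm_solution:
  assumes "solves_linear_ivp B x X" "x \<noteq> 0"
  shows "((\<lambda>t. norm (X t)) has_real_derivative (x \<bullet> (B *v x)) / norm x) (at 0)"
proof -
  have "X 0 = x" and X: "(X has_derivative (\<lambda>h. h *\<^sub>R (B *v x))) (at 0)"
    using assms(1) unfolding solves_linear_ivp_def has_vector_derivative_def by metis+
  then have "((\<lambda>t. norm (X t)) has_derivative (\<lambda>h. (h *\<^sub>R (B *v x)) \<bullet> sgn x)) (at 0)"
    using has_derivative_compose[OF X has_derivative_norm[of "X 0"]] assms(2) by (simp add: inner_commute)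
  then show ?thesis
    unfolding has_field_derivative_def
    by (rule has_derivative_eq_rhs)
      (auto simp: sgn_div_norm inner_commute divide_inverse mult_ac)
qed

text \<open>Growth rates are Rayleigh quotients of \<open>B\<close>, so the reactivity is their
  maximum. A solution has to be supplied only at the maximiser \<open>x\<close>.\<close>

lemma has_reactivityI:
  assumes "x \<noteq> 0" "solves_linear_ivp B x X" "x \<bullet> (B *v x) = \<rho> * (x \<bullet> x)"
    and "\<And>y. y \<bullet> (B *v y) \<le> \<rho> * (y \<bullet> y)"
  shows "has_reactivity B \<rho>"
  unfolding has_reactivity_def
proof (intro conjI ballI)
  have "1 / norm x * ((x \<bullet> (B *v x)) / norm x) = \<rho>"
    using assms(1,3) by (simp add: dot_square_norm power2_eq_square)
  then show "\<rho> \<in> initial_growth_rates B"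
    unfolding initial_growth_rates_def
    using assms(1,2) has_real_derivative_norm_solution[OF assms(2,1)] by force
next
  fix s assume "s \<in> initial_growth_rates B"
  then obtain y Y D where y: "y \<noteq> 0" "solves_linear_ivp B y Y" "s = 1 / norm y * D"
    and "((\<lambda>t. norm (Y t)) has_real_derivative D) (at 0)"
    unfolding initial_growth_rates_def by blast
  then have "D = (y \<bullet> (B *v y)) / norm y"
    using DERIV_unique has_real_derivative_norm_solution by blast
  then show "s \<le> \<rho>"
    using y assms(4)[of y] by (simp add: dot_square_norm power2_eq_square divide_le_eq)
qed

text \<open>Writing the product as a difference of two squares, one drops the first and bounds the
  second by Cauchy-Schwarz.\<close>

lemma inner_mult_inner_ge:
  fixes n v x :: "'a :: real_inner"
  assumes "n \<noteq> 0" "v \<noteq> 0"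
  shows "(n \<bullet> x) * (v \<bullet> x) \<ge> (n \<bullet> v - norm n * norm v) / 2 * (x \<bullet> x)"
proof -
  define y where "y = norm n *\<^sub>R v - norm v *\<^sub>R n"
  define k where "k = norm n * norm v"
  have k: "k > 0"
    using assms by (simp add: k_def)
  have yy: "y \<bullet> y = 2 * k * (k - n \<bullet> v)"
    unfolding y_def k_def inner_diff
    by (simp add: inner_commute dot_square_norm power2_eq_square algebra_simps)
  \<comment> \<open>This is \<open>4 p q = (p + q)^2 - (p - q)^2\<close> with
    \<open>p = norm n * (v \<bullet> x)\<close> and \<open>q = norm v * (n \<bullet> x)\<close>;
    here \<open>p - q = y \<bullet> x\<close>.\<close>
  have "4 * k * ((n \<bullet> x) * (v \<bullet> x)) = (norm n * (v \<bullet> x) + norm v * (n \<bullet> x))\<^sup>2 - (y \<bullet> x)\<^sup>2"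
    by (simp add: y_def k_def inner_diff power2_eq_square algebra_simps)
  also have "\<dots> \<ge> - (y \<bullet> y) * (x \<bullet> x)"
    using Cauchy_Schwarz_ineq[of y x] zero_le_power2[of "norm n * (v \<bullet> x) + norm v * (n \<bullet> x)"]
    by linarith
  finally have "4 * k * ((n \<bullet> v - k) / 2 * (x \<bullet> x)) \<le> 4 * k * ((n \<bullet> x) * (v \<bullet> x))"
    by (simp add: yy algebra_simps)
  then show ?thesis
    using k by (subst (asm) mult_le_cancel_left_pos) (auto simp: k_def)
qed

lemma has_reactivity_rank_one_update:
  assumes nv: "n \<bullet> v = 1" and k: "norm n * norm v > 1" and "b \<ge> 0"
  shows "has_reactivity (rank_one_update a b n v) (b * (norm n * norm v - 1) / 2 - a)"
proof -
  define k where "k = norm n * norm v"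
  \<comment> \<open>Equality case of \<open>inner_mult_inner_ge\<close>: at this vector the dropped
    square vanishes and Cauchy-Schwarz is sharp.\<close>
  define x where "x = norm n *\<^sub>R v - norm v *\<^sub>R n"
  have nx: "n \<bullet> x = norm n * (1 - k)" and vx: "v \<bullet> x = norm v * (k - 1)"
    using nv by (simp_all add: x_def k_def inner_diff inner_commute dot_square_norm
        power2_eq_square algebra_simps)
  have "x \<bullet> x = norm n * (v \<bullet> x) - norm v * (n \<bullet> x)"
    by (subst (1) x_def) (simp add: inner_diff_left)
  then have xx: "x \<bullet> x = 2 * k * (k - 1)"
    unfolding nx vx by (simp add: k_def algebra_simps)
  have form: "y \<bullet> (rank_one_update a b n v *v y) = - a * (y \<bullet> y) - b * ((n \<bullet> y) * (v \<bullet> y))" for y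
    by (simp add: rank_one_update_mult_vec inner_diff_right inner_commute)
  have "x \<noteq> 0"
    using xx k by (auto simp: k_def)
  moreover have "x \<bullet> (rank_one_update a b n v *v x) = (b * (k - 1) / 2 - a) * (x \<bullet> x)"
    unfolding form nx vx xx by (simp add: k_def field_simps)
  moreover have "y \<bullet> (rank_one_update a b n v *v y) \<le> (b * (k - 1) / 2 - a) * (y \<bullet> y)" for y
  proof -
    have "n \<noteq> 0" "v \<noteq> 0"
      using nv by auto
    \<comment> \<open>The sign of \<open>b\<close> turns the lower bound for the product into an
      upper bound for the growth.\<close>
    then have "b * ((1 - k) / 2 * (y \<bullet> y)) \<le> b * ((n \<bullet> y) * (v \<bullet> y))"
      using inner_mult_inner_ge[of n v y] nv \<open>b \<ge> 0\<close>
      by (intro mult_left_mono) (auto simp: k_def)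
    then show ?thesis
      unfolding form by (simp add: field_simps)
  qed
  ultimately show ?thesis
    unfolding k_def by (rule has_reactivityI[OF _ solves_rank_one_update[OF nv]])
qed

lemma oblique_dual_vector:
  fixes u v :: "'a :: real_inner"
  assumes "u \<noteq> v" "independent {u, v}" "\<not> orthogonal u v"
  obtains n where "n \<bullet> u = 0" "n \<bullet> v = 1" "norm n * norm v > 1"
proof -
  define w where "w = v - ((u \<bullet> v) / (u \<bullet> u)) *\<^sub>R u"
  have u: "u \<noteq> 0"
    using assms(3) by (auto simp: orthogonal_def)
  have "v \<notin> span {u}"
    using assms(1,2) by (simp add: insert_commute[of u] independent_insert)
  then have w: "w \<noteq> 0"
    by (auto simp: w_def span_singleton)
  have wu: "w \<bullet> u = 0"
    using u by (simp add: w_def inner_diff_left inner_commute[of u v])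
  have wv: "w \<bullet> v = w \<bullet> w"
    using wu by (simp add: w_def inner_diff_right)
  \<comment> \<open>Pythagoras: the component of \<open>v\<close> along \<open>u\<close> is nonzero
    by non-orthogonality, so \<open>w\<close> is strictly shorter than \<open>v\<close>. The dual
    vector has norm \<open>1 / norm w\<close>, whence the strict bound.\<close>
  have "v \<bullet> v = w \<bullet> w + (u \<bullet> v)\<^sup>2 / (u \<bullet> u)"
    using u by (simp add: w_def inner_diff inner_commute power2_eq_square)
  moreover have "(u \<bullet> v)\<^sup>2 / (u \<bullet> u) > 0"
    using u assms(3) by (simp add: orthogonal_def)
  ultimately have "norm w < norm v"
    by (simp add: norm_lt)
  show thesis
  proof
    show "(w /\<^sub>R (w \<bullet> w)) \<bullet> u = 0" "(w /\<^sub>R (w \<bullet> w)) \<bullet> v = 1"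
      using w wu wv by auto
    show "norm (w /\<^sub>R (w \<bullet> w)) * norm v > 1"
      using w \<open>norm w < norm v\<close> by (simp add: dot_square_norm power2_eq_square field_simps)
  qed
qed

theorem theorem7p4:
  fixes V\<^sub>1 V\<^sub>2 :: "real ^ 2" and \<rho> :: real
  assumes "V\<^sub>1 \<noteq> V\<^sub>2" and "independent {V\<^sub>1, V\<^sub>2}"
    and "\<not> orthogonal V\<^sub>1 V\<^sub>2"
    and "\<rho> > 0"
  shows "\<exists>B :: real ^ 2 ^ 2. eigenvector B V\<^sub>1 \<and> eigenvector B V\<^sub>2 \<and>
           origin_attractor B \<and> has_reactivity B \<rho>"
proof -
  obtain n where n: "n \<bullet> V\<^sub>1 = 0" "n \<bullet> V\<^sub>2 = 1" "norm n * norm V\<^sub>2 > 1"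
    using oblique_dual_vector assms(1-3) by blast
  define b where "b = 2 * (\<rho> + 1) / (norm n * norm V\<^sub>2 - 1)"
  define B where "B = rank_one_update 1 b n V\<^sub>2"
  have b: "b > 0"
    using n assms(4) by (simp add: b_def)
  have nz: "V\<^sub>1 \<noteq> 0" "V\<^sub>2 \<noteq> 0"
    using assms(3) by (auto simp: orthogonal_def)
  \<comment> \<open>The rank-one term vanishes on the kernel of \<open>n\<close> and scales the
    second vector by \<open>- b\<close>.\<close>
  have "B *v V\<^sub>1 = (- 1) *s V\<^sub>1" "B *v V\<^sub>2 = (- 1 - b) *s V\<^sub>2"
    using n by (simp_all add: B_def rank_one_update_mult_vec scalar_mult_eq_scaleR algebra_simps)
  then have "eigenvector B V\<^sub>1" "eigenvector B V\<^sub>2"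
    using nz unfolding eigenvector_def eigenpair_def by blast+
  moreover have "origin_attractor B"
    unfolding B_def using n b by (intro origin_attractor_rank_one_update) auto
  moreover have "b * (norm n * norm V\<^sub>2 - 1) / 2 - 1 = \<rho>"
    using n by (simp add: b_def field_simps)
  then have "has_reactivity B \<rho>"
    using has_reactivity_rank_one_update[OF n(2,3), of b 1] b by (simp add: B_def)
  ultimately show ?thesis
    by blast
qed

end
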